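(* The space of CHFIFs $\mathcal{S}_0^1$ (associated with the fixed nodes $x_0<x_1<\dots<x_N$ and the fixed parameters $\alpha_n,\beta_n,\gamma_n$, $n=1,\dots,N$) has dimension $2N$ as a real vector space.
   Context: Let $N$ be a positive integer, let $-\infty<x_0<x_1<\dots<x_N<\infty$ be fixed nodes and put $I=[x_0,x_N]$, $I_n=[x_{n-1},x_n]$. For $n=1,\dots,N$ let $L_n:I\to I_n$, $L_n(x)=a_nx+b_n$ with $a_n=\frac{x_n-x_{n-1}}{x_N-x_0}$ and $b_n=\frac{x_Nx_{n-1}-x_0x_n}{x_N-x_0}$. Fix real parameters $\alpha_n,\gamma_n$ ("free variables") and $\beta_n$ ("constrained variables") with $|\alpha_n|<1$, $|\gamma_n|<1$, $|\beta_n|+|\gamma_n|<1$ for $n=1,\dots,N$. For generalized interpolation data $\{(x_i,y_i,z_i)\in\mathbb{R}^3: i=0,\dots,N\}$ let $F_n(x,y,z)=(\alpha_ny+\beta_nz+p_n(x),\ \gamma_nz+q_n(x))$, where $p_n(x)=c_nx+d_n$ and $q_n(x)=e_nx+h_n$ are the polynomials of degree at most one determined by the join-up conditions $F_n(x_0,y_0,z_0)=(y_{n-1},z_{n-1})$ and $F_n(x_N,y_N,z_N)=(y_n,z_n)$. The attractor of the iterated function system $\{I\times\mathbb{R}^2;\ \omega_n(x,y,z)=(L_n(x),F_n(x,y,z)),\ n=1,\dots,N\}$ is the graph of a continuous function $f=(f_1,f_2):I\to\mathbb{R}^2$ with $f(x_i)=(y_i,z_i)$; equivalently, $f$ is the unique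 continuous function satisfying, for all $x\in I$ and $n=1,\dots,N$, $$f_1(L_n(x))=\alpha_nf_1(x)+\beta_nf_2(x)+p_n(x),\qquad f_2(L_n(x))=\gamma_nf_2(x)+q_n(x).$$ The component $f_1$ is called the Coalescence Hidden-variable Fractal Interpolation Function (CHFIF) for the data $\{(x_i,y_i)\}$, and $f_2$ is an Affine Fractal Interpolation Function (AFIF) through $\{(x_i,z_i)\}$. $\mathcal{S}_0$ is the real vector space (pointwise operations) of all functions $f=(f_1,f_2):I\to\mathbb{R}^2$ obtained in this way as $(y_0,\dots,y_N)$ and $(z_0,\dots,z_N)$ range over $\mathbb{R}^{N+1}$, the nodes and the parameters $\alpha_n,\beta_n,\gamma_n$ being fixed. The space of CHFIFs $\mathcal{S}_0^1$ is the set of first components $f_1$ of functions $f=(f_1,f_2)\in\mathcal{S}_0$, with pointwise operations (and the maximum metric $\max_{x\in I}|f(x)-g(x)|$).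
   Formalization: The formal theorem assumes in addition that N = 1 or that some β_n is nonzero; if N ≥ 2 and all β_n = 0, the CHFIFs are determined by y_0,…,y_N alone and the space has dimension N+1 instead of 2N, so the claim as stated fails there. *)

theory Defs
  imports "HOL-Analysis.Analysis" "HOL-Library.Function_Algebras"
begin

text \<open>
  Real functions form a vector space over the reals under the pointwise operations; addition and
  zero come from \<^theory>\<open>HOL-Library.Function_Algebras\<close>.
\<close>

interpretation fun_vs: vector_space "\<lambda>(c::real) (f::real \<Rightarrow> real) t. c * f t"
  by unfold_locales (auto simp: fun_eq_iff algebra_simps)

definition affine_contraction :: "nat \<Rightarrow> (nat \<Rightarrow> real) \<Rightarrow> nat \<Rightarrow> real \<Rightarrow> real" where
  "affine_contraction N x n t =
     (x n - x (n - 1)) / (x N - x 0) * t + (x N * x (n - 1) - x 0 * x n) / (x N - x 0)"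

definition ifs_vertical_map ::
  "(nat \<Rightarrow> real) \<Rightarrow> (nat \<Rightarrow> real) \<Rightarrow> (nat \<Rightarrow> real) \<Rightarrow> (nat \<Rightarrow> real) \<Rightarrow> (nat \<Rightarrow> real) \<Rightarrow>
   (nat \<Rightarrow> real) \<Rightarrow> (nat \<Rightarrow> real) \<Rightarrow> nat \<Rightarrow> real \<Rightarrow> real \<times> real \<Rightarrow> real \<times> real" where
  "ifs_vertical_map \<alpha> \<beta> \<gamma> c d e h n t w =
     (\<alpha> n * fst w + \<beta> n * snd w + (c n * t + d n), \<gamma> n * snd w + (e n * t + h n))"

definition join_up ::
  "nat \<Rightarrow> (nat \<Rightarrow> real) \<Rightarrow> (nat \<Rightarrow> real) \<Rightarrow> (nat \<Rightarrow> real) \<Rightarrow>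
   (nat \<Rightarrow> real \<Rightarrow> real \<times> real \<Rightarrow> real \<times> real) \<Rightarrow> bool" where
  "join_up N x y z F \<longleftrightarrow>
     (\<forall>n\<in>{1..N}. F n (x 0) (y 0, z 0) = (y (n - 1), z (n - 1)) \<and>
                 F n (x N) (y N, z N) = (y n, z n))"

text \<open>
  A function on \<open>I = {x 0..x N}\<close> is represented by its extension by zero to the whole real line,
  so that equality and linear (in)dependence of representatives are those of the functions on
  \<open>I\<close>. The conditions \<open>f (x i) = (y i, z i)\<close> are consequences of the functional equation and the
  join-up conditions, and so is the uniqueness of \<open>f\<close> when all parameters have modulus less than 1.
\<close>

definition hidden_variable_fif ::
  "nat \<Rightarrow> (nat \<Rightarrow> real) \<Rightarrow> (nat \<Rightarrow> real) \<Rightarrow> (nat \<Rightarrow> real) \<Rightarrow> (nat \<Rightarrow> real) \<Rightarrow>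
   (nat \<Rightarrow> real) \<Rightarrow> (nat \<Rightarrow> real) \<Rightarrow> (real \<Rightarrow> real \<times> real) \<Rightarrow> bool" where
  "hidden_variable_fif N x \<alpha> \<beta> \<gamma> y z f \<longleftrightarrow>
     continuous_on {x 0..x N} f \<and> (\<forall>t. t \<notin> {x 0..x N} \<longrightarrow> f t = (0, 0)) \<and>
     (\<exists>c d e h. let F = ifs_vertical_map \<alpha> \<beta> \<gamma> c d e h in
        join_up N x y z F \<and>
        (\<forall>n\<in>{1..N}. \<forall>t\<in>{x 0..x N}. f (affine_contraction N x n t) = F n t (f t)))"

definition S0 ::
  "nat \<Rightarrow> (nat \<Rightarrow> real) \<Rightarrow> (nat \<Rightarrow> real) \<Rightarrow> (nat \<Rightarrow> real) \<Rightarrow> (nat \<Rightarrow> real) \<Rightarrow>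
   (real \<Rightarrow> real \<times> real) set" where
  "S0 N x \<alpha> \<beta> \<gamma> = {f. \<exists>y z. hidden_variable_fif N x \<alpha> \<beta> \<gamma> y z f}"

text \<open>
  If all \<open>\<beta> n\<close> vanish, the first component does not depend on the second one, and the
  space below has dimension \<open>N + 1\<close>, which differs from \<open>2 * N\<close> unless \<open>N = 1\<close>.
\<close>

definition chfif_space ::
  "nat \<Rightarrow> (nat \<Rightarrow> real) \<Rightarrow> (nat \<Rightarrow> real) \<Rightarrow> (nat \<Rightarrow> real) \<Rightarrow> (nat \<Rightarrow> real) \<Rightarrow>
   (real \<Rightarrow> real) set" where
  "chfif_space N x \<alpha> \<beta> \<gamma> = (\<lambda>f. fst \<circ> f) ` S0 N x \<alpha> \<beta> \<gamma>"

text \<open>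
  The functional equation in \<^const>\<open>hidden_variable_fif\<close> says precisely that the graph of \<open>f\<close> is
  invariant under the iterated function system.
\<close>

lemma affine_contraction_image:
  fixes x :: "nat \<Rightarrow> real"
  assumes "strict_mono_on {0..N} x" "n \<in> {1..N}"
  shows "affine_contraction N x n ` {x 0..x N} = {x (n - 1)..x n}"
proof -
  have N: "x 0 < x N" and n: "x (n - 1) < x n"
    using assms by (auto intro!: strict_mono_onD[OF assms(1)])
  have D: "x N - x 0 \<noteq> 0" using N by simp
  define a where "a = (x n - x (n - 1)) / (x N - x 0)"
  define b where "b = (x N * x (n - 1) - x 0 * x n) / (x N - x 0)"
  have "a > 0" unfolding a_def using N n by simp
  moreover have "a * x 0 + b = x (n - 1)"
  proof -
    have "a * x 0 + b = (x (n - 1) * (x N - x 0)) / (x N - x 0)"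
      unfolding a_def b_def by (simp add: add_divide_distrib[symmetric] algebra_simps)
    then show ?thesis using D by simp
  qed
  moreover have "a * x N + b = x n"
  proof -
    have "a * x N + b = (x n * (x N - x 0)) / (x N - x 0)"
      unfolding a_def b_def by (simp add: add_divide_distrib[symmetric] algebra_simps)
    then show ?thesis using D by simp
  qed
  moreover have "affine_contraction N x n = (\<lambda>t. a * t + b)"
    by (simp add: affine_contraction_def fun_eq_iff a_def b_def)
  ultimately show ?thesis
    using N by (simp add: image_affinity_atLeastAtMost)
qed

lemma nodes_cover:
  fixes x :: "nat \<Rightarrow> real"
  assumes "strict_mono_on {0..N} x" "1 \<le> N"
  shows "(\<Union>n\<in>{1..N}. {x (n - 1)..x n}) = {x 0..x N}"
  using assms(2,1)
proof (induction N rule: dec_induct)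
  case base
  then show ?case by simp
next
  case (step m)
  have "strict_mono_on {0..m} x"
    using step.prems by (rule monotone_on_subset) auto
  moreover have "x 0 \<le> x m" "x m \<le> x (Suc m)"
    using step by (auto intro!: strict_mono_on_leD[OF step.prems])
  ultimately show ?case
    using step.IH by (auto simp: atLeastAtMostSuc_conv)
qed

lemma graph_invariant_iff_functional_equation:
  fixes x :: "nat \<Rightarrow> real" and f :: "real \<Rightarrow> real \<times> real"
  assumes "strict_mono_on {0..N} x" "1 \<le> N"
  shows "(\<Union>n\<in>{1..N}. (\<lambda>(t, w). (affine_contraction N x n t, F n t w)) `
            {(t, f t) |t. t \<in> {x 0..x N}}) = {(t, f t) |t. t \<in> {x 0..x N}} \<longleftrightarrow>
         (\<forall>n\<in>{1..N}. \<forall>t\<in>{x 0..x N}. f (affine_contraction N x n t) = F n t (f t))"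
    (is "?A = ?G \<longleftrightarrow> ?R")
proof
  assume A: "?A = ?G"
  show ?R
  proof (intro ballI)
    fix n t assume "n \<in> {1..N}" "t \<in> {x 0..x N}"
    then have "(affine_contraction N x n t, F n t (f t)) \<in> ?A" by force
    then show "f (affine_contraction N x n t) = F n t (f t)"
      unfolding A by auto
  qed
next
  assume R: ?R
  have im: "(\<Union>n\<in>{1..N}. affine_contraction N x n ` {x 0..x N}) = {x 0..x N}"
    using affine_contraction_image[OF assms(1)] nodes_cover[OF assms] by simp
  have "?A = (\<lambda>t. (t, f t)) ` (\<Union>n\<in>{1..N}. affine_contraction N x n ` {x 0..x N})"
    using R by (force simp: image_iff)
  then show "?A = ?G" unfolding im by auto
qed

end

theory Submission
  imports Defs
begin

text \<open>
  A member of \<^const>\<open>S0\<close> is determined by its values at the \<open>N + 1\<close> nodes, and these values in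
  \<open>\<real>\<^sup>2\<close> can be prescribed freely, so \<^const>\<open>S0\<close> has dimension \<open>2 * N + 2\<close>. The dimension of
  \<^const>\<open>chfif_space\<close> is therefore \<open>2 * N + 2\<close> minus the dimension of the kernel of
  \<open>(f\<^sub>1, f\<^sub>2) \<mapsto> f\<^sub>1\<close>. If \<open>f\<^sub>1 = 0\<close>, the first functional equation reads
  \<open>\<beta> n * f\<^sub>2 t + (c n * t + d n) = 0\<close>, and one nonzero \<open>\<beta> n\<close> forces \<open>f\<^sub>2\<close> to be affine.
  Conversely every affine \<open>f\<^sub>2\<close> occurs together with \<open>f\<^sub>1 = 0\<close>, because the affine terms of the
  two equations can absorb it (\<open>S_affine_snd\<close>). The kernel is thus the plane of affine functions.

  Instead of forming a quotient, the proof picks in each class modulo this plane the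
  representative whose second component vanishes at both end points (\<open>chfif_normalized\<close>). Such a
  representative is given by \<open>N + 1\<close> values of \<open>f\<^sub>1\<close> and \<open>N - 1\<close> values of \<open>f\<^sub>2\<close> at the interior
  nodes, and it is zero as soon as \<open>f\<^sub>1\<close> is (\<open>S_zero_if_fst_zero\<close>). The first components of the
  \<open>2 * N\<close> cardinal functions for these values form a basis. For \<open>N = 1\<close> there are no interior
  nodes, and a normalized pair with \<open>f\<^sub>1 = 0\<close> vanishes at both nodes, hence everywhere.

  Both the existence and the uniqueness of the interpolant are reduced to a single scalar equation
  \<open>g (L n t) = \<gamma> n * g t + r n t\<close> with continuous \<open>r n\<close> (\<open>interpolant_exists\<close>,
  \<open>interpolant_zero\<close>): the system is triangular, so \<open>f\<^sub>2\<close> is found first, and \<open>\<beta> n * f\<^sub>2\<close> is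
  then part of the inhomogeneity in the equation for \<open>f\<^sub>1\<close>.
\<close>

section \<open>Nodes and the maps between the intervals\<close>

lemma affine_interpolation:
  fixes s t u v :: real
  assumes "s \<noteq> t"
  obtains a b where "a * s + b = u" "a * t + b = v"
proof
  define a where "a = (v - u) / (t - s)"
  have "a * (t - s) = v - u" using assms by (simp add: a_def)
  then show "a * s + (u - a * s) = u" "a * t + (u - a * s) = v"
    by (simp_all add: algebra_simps)
qed

lemma affine_two_zeros:
  fixes a b s t :: real
  assumes "s \<noteq> t" "a * s + b = 0" "a * t + b = 0"
  shows "a = 0" "b = 0"
proof -
  have "a * (t - s) = (a * t + b) - (a * s + b)" by (simp add: algebra_simps)
  then have "a * (t - s) = 0" using assms by simp
  then show "a = 0" using assms(1) by simp
  then show "b = 0" using assms(2) by simp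
qed

locale interpolation_nodes =
  fixes N :: nat and x :: "nat \<Rightarrow> real"
  assumes N_pos: "1 \<le> N" and x_mono: "strict_mono_on {0..N} x"
begin

abbreviation I where "I \<equiv> {x 0..x N}"
abbreviation L where "L \<equiv> affine_contraction N x"

lemma x_less: "i < j \<Longrightarrow> j \<le> N \<Longrightarrow> x i < x j"
  by (rule strict_mono_onD[OF x_mono]) auto

lemma x_le: "i \<le> j \<Longrightarrow> j \<le> N \<Longrightarrow> x i \<le> x j"
  by (rule strict_mono_on_leD[OF x_mono]) auto

lemma x_ends: "x 0 < x N"
  using x_less[of 0 N] N_pos by simp

lemma x_in_I: "i \<le> N \<Longrightarrow> x i \<in> I"
  using x_le[of 0 i] x_le[of i N] by simp

lemma L_alt:
  "L n t = x (n - 1) + (x n - x (n - 1)) / (x N - x 0) * (t - x 0)"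
proof -
  have "x N - x 0 \<noteq> 0" using x_ends by simp
  then show ?thesis
    unfolding affine_contraction_def by (simp add: divide_simps) (simp add: algebra_simps)
qed

lemma L_left: "L n (x 0) = x (n - 1)"
  by (simp add: L_alt)

lemma L_right: "L n (x N) = x n"
  using x_ends by (simp add: L_alt)

lemma L_image: "n \<in> {1..N} \<Longrightarrow> L n ` I = {x (n - 1)..x n}"
  by (rule affine_contraction_image[OF x_mono])

lemma L_in_I:
  assumes "n \<in> {1..N}" "t \<in> I"
  shows "L n t \<in> I" "x (n - 1) \<le> L n t" "L n t \<le> x n"
proof -
  have "L n t \<in> {x (n - 1)..x n}" using L_image[OF assms(1)] assms(2) by blast
  then show "x (n - 1) \<le> L n t" "L n t \<le> x n" by auto
  then show "L n t \<in> I"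
    using x_le[of 0 "n - 1"] x_le[of n N] assms(1) by fastforce
qed

lemma L_cover:
  assumes "s \<in> I"
  obtains n t where "n \<in> {1..N}" "t \<in> I" "s = L n t"
proof -
  have "s \<in> (\<Union>n\<in>{1..N}. L n ` I)"
    using assms nodes_cover[OF x_mono N_pos] L_image by auto
  then show ?thesis using that by blast
qed

text \<open>
  The inverse of \<^term>\<open>L n\<close>, extended to a continuous function on the whole line by clamping its
  argument to the \<^term>\<open>n\<close>-th subinterval.
\<close>

definition L_inv :: "nat \<Rightarrow> real \<Rightarrow> real" where
  "L_inv n t =
     x 0 + (x N - x 0) * ((max (x (n - 1)) (min (x n) t) - x (n - 1)) / (x n - x (n - 1)))"

lemma L_inv_left: "n \<in> {1..N} \<Longrightarrow> t \<le> x (n - 1) \<Longrightarrow> L_inv n t = x 0"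
  using x_less[of "n - 1" n] by (simp add: L_inv_def)

lemma L_inv_right: "n \<in> {1..N} \<Longrightarrow> x n \<le> t \<Longrightarrow> L_inv n t = x N"
  using x_less[of "n - 1" n] by (simp add: L_inv_def)

lemma L_inv_in_I:
  assumes "n \<in> {1..N}"
  shows "L_inv n t \<in> I"
proof -
  define q where "q = (max (x (n - 1)) (min (x n) t) - x (n - 1)) / (x n - x (n - 1))"
  have "x (n - 1) < x n" using x_less[of "n - 1" n] assms by simp
  then have "0 \<le> q" "q \<le> 1" by (auto simp: q_def divide_simps)
  then have "0 \<le> (x N - x 0) * q" "(x N - x 0) * q \<le> (x N - x 0) * 1"
    using x_ends by (auto intro!: mult_left_mono mult_nonneg_nonneg)
  then show ?thesis unfolding L_inv_def q_def[symmetric] by simp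
qed

lemma L_inv_L:
  assumes "n \<in> {1..N}" "t \<in> I"
  shows "L_inv n (L n t) = t"
proof -
  have "x (n - 1) < x n" using x_less[of "n - 1" n] assms by simp
  moreover have "max (x (n - 1)) (min (x n) (L n t)) = L n t"
    using L_in_I[OF assms] by simp
  ultimately show ?thesis
    unfolding L_inv_def using x_ends by (simp add: L_alt)
qed

lemma continuous_L_inv: "n \<in> {1..N} \<Longrightarrow> continuous_on A (L_inv n)"
  unfolding L_inv_def using x_less[of "n - 1" n] by (auto intro!: continuous_intros)

section \<open>Gluing functions on consecutive intervals\<close>

text \<open>
  The piece \<^term>\<open>h n\<close> is meant to be a function on the whole line that is constant to the left and
  to the right of the \<^term>\<open>n\<close>-th subinterval, with the values \<^term>\<open>z (n - 1)\<close> and \<^term>\<open>z n\<close>.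
  Written as a sum of increments, the glued function is continuous simply because its pieces are.
\<close>

definition glue :: "(nat \<Rightarrow> real) \<Rightarrow> (nat \<Rightarrow> real \<Rightarrow> real) \<Rightarrow> real \<Rightarrow> real" where
  "glue z h t = z 0 + (\<Sum>n=1..N. h n t - z (n - 1))"

text \<open>
  At a point of the \<^term>\<open>m\<close>-th subinterval the increments with smaller index have been completed and
  telescope to \<^term>\<open>z (m - 1) - z 0\<close>, while those with larger index have not started and vanish.
\<close>

lemma glue_pieces:
  assumes left: "\<And>n t. n \<in> {1..N} \<Longrightarrow> t \<le> x (n - 1) \<Longrightarrow> h n t = z (n - 1)"
    and right: "\<And>n t. n \<in> {1..N} \<Longrightarrow> x n \<le> t \<Longrightarrow> h n t = z n"
  shows "n \<in> {1..N} \<Longrightarrow> x (n - 1) \<le> t \<Longrightarrow> t \<le> x n \<Longrightarrow> glue z h t = h n t"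
    and "t \<le> x 0 \<Longrightarrow> glue z h t = z 0"
    and "x N \<le> t \<Longrightarrow> glue z h t = z N"
proof -
  have done_part: "z 0 + (\<Sum>n=1..m. h n t - z (n - 1)) = z m" if "m \<le> N" "x m \<le> t" for m t
    using that
  proof (induction m)
    case (Suc m)
    then have "x m \<le> t" using x_le[of m "Suc m"] by linarith
    then have "z 0 + (\<Sum>n=1..m. h n t - z (n - 1)) = z m" using Suc by simp
    then show ?case using right[of "Suc m" t] Suc.prems by simp
  qed simp
  have rest: "(\<Sum>n=Suc m..N. h n t - z (n - 1)) = 0" if "t \<le> x m" for m t
  proof (rule sum.neutral, intro ballI)
    fix n assume n: "n \<in> {Suc m..N}"
    then have "t \<le> x (n - 1)" using x_le[of m "n - 1"] that by fastforce
    then show "h n t - z (n - 1) = 0" using left[of n t] n by simp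
  qed
  show "glue z h t = h n t" if n: "n \<in> {1..N}" "x (n - 1) \<le> t" "t \<le> x n"
  proof -
    obtain m where m: "n = Suc m" using n by (cases n) auto
    have split: "{1..N} = {1..m} \<union> ({n} \<union> {Suc n..N})" using n m by auto
    have "glue z h t = z 0 + (\<Sum>n=1..m. h n t - z (n - 1)) + ((h n t - z m) +
        (\<Sum>n=Suc n..N. h n t - z (n - 1)))"
      unfolding glue_def split using m by (subst sum.union_disjoint; simp)
    then show ?thesis using done_part[of m t] rest[of t n] n m by simp
  qed
  show "glue z h t = z 0" if "t \<le> x 0"
    using rest[OF that] by (simp add: glue_def)
  show "glue z h t = z N" if "x N \<le> t"
    using done_part[OF _ that] by (simp add: glue_def)
qed

section \<open>Scalar self-referential functional equations\<close>

text \<open>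
  The Read--Bajraktarevic operator sends \<^term>\<open>g\<close> to the function that equals
  \<open>t \<mapsto> \<gamma> n * g (L\<^sub>n\<^sup>-\<^sup>1 t) + r n (L\<^sub>n\<^sup>-\<^sup>1 t)\<close> on the \<^term>\<open>n\<close>-th subinterval. For functions with the
  correct end point values the pieces match at the nodes by the join-up conditions, and the
  operator contracts the supremum distance by the factor \<open>max \<bar>\<gamma> n\<bar> < 1\<close>, so Banach's theorem gives
  a fixed point. The inhomogeneities are arbitrary continuous functions so that the lemma applies
  to both components of the system.
\<close>

lemma interpolant_exists:
  fixes \<gamma> z :: "nat \<Rightarrow> real" and r :: "nat \<Rightarrow> real \<Rightarrow> real"
  assumes \<gamma>: "\<And>n. n \<in> {1..N} \<Longrightarrow> \<bar>\<gamma> n\<bar> < 1"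
    and r: "\<And>n. n \<in> {1..N} \<Longrightarrow> continuous_on I (r n)"
    and join0: "\<And>n. n \<in> {1..N} \<Longrightarrow> \<gamma> n * z 0 + r n (x 0) = z (n - 1)"
    and joinN: "\<And>n. n \<in> {1..N} \<Longrightarrow> \<gamma> n * z N + r n (x N) = z n"
  obtains g where "continuous_on I g"
    and "\<And>n t. n \<in> {1..N} \<Longrightarrow> t \<in> I \<Longrightarrow> g (L n t) = \<gamma> n * g t + r n t"
    and "\<And>i. i \<le> N \<Longrightarrow> g (x i) = z i"
proof -
  define h where "h g n t = \<gamma> n * g (L_inv n t) + r n (L_inv n t)" for g :: "real \<Rightarrow> real" and n t
  define T where "T g = glue z (h g)" for g
  define S :: "(real \<Rightarrow>\<^sub>C real) set"
    where "S = PiC {x 0, x N} (\<lambda>t. {if t = x 0 then z 0 else z N})"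
  have S_iff: "g \<in> S \<longleftrightarrow> apply_bcontfun g (x 0) = z 0 \<and> apply_bcontfun g (x N) = z N" for g
    using x_ends by (auto simp: S_def mem_PiC_iff)
  (* the join-up conditions are what makes the pieces h g n constant outside their subintervals *)
  have pieces:
    "n \<in> {1..N} \<Longrightarrow> x (n - 1) \<le> t \<Longrightarrow> t \<le> x n \<Longrightarrow> T g t = h g n t"
    "t \<le> x 0 \<Longrightarrow> T g t = z 0" "x N \<le> t \<Longrightarrow> T g t = z N"
    if "g (x 0) = z 0" "g (x N) = z N" for g n t
    using glue_pieces[of "h g" z] that join0 joinN L_inv_left L_inv_right
    by (auto simp: T_def h_def)
  have T_cont: "continuous_on UNIV (T g)" if g: "continuous_on UNIV g" for g
  proof -
    have "continuous_on UNIV (\<lambda>t. r n (L_inv n t))" if "n \<in> {1..N}" for n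
      by (rule continuous_on_compose2[OF r[OF that] continuous_L_inv[OF that]])
        (use L_inv_in_I[OF that] in auto)
    moreover have "continuous_on UNIV (\<lambda>t. g (L_inv n t))" if "n \<in> {1..N}" for n
      by (rule continuous_on_compose2[OF g continuous_L_inv[OF that]]) auto
    ultimately show ?thesis
      unfolding T_def glue_def h_def by (intro continuous_intros) auto
  qed
  (* T g is constant on either side of I, so its range is the compact image of I *)
  have T_bcontfun: "T (apply_bcontfun g) \<in> bcontfun" if "g \<in> S" for g
  proof -
    let ?T = "T (apply_bcontfun g)"
    have g: "apply_bcontfun g (x 0) = z 0" "apply_bcontfun g (x N) = z N"
      using that S_iff by auto
    have cont: "continuous_on UNIV ?T" by (rule T_cont) simp
    have "compact (?T ` I)"
      by (intro compact_continuous_image continuous_on_subset[OF cont]) auto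
    moreover have "range ?T \<subseteq> ?T ` I"
    proof (rule image_subsetI)
      fix t
      show "?T t \<in> ?T ` I"
      proof (cases "t \<in> I")
        case False
        then have "?T t = ?T (x 0) \<or> ?T t = ?T (x N)"
          using pieces[OF g] by (smt (verit) atLeastAtMost_iff)
        then show ?thesis using x_ends by auto
      qed auto
    qed
    ultimately show ?thesis
      using cont bounded_subset compact_imp_bounded unfolding bcontfun_def by blast
  qed
  have app: "apply_bcontfun (Bcontfun (T (apply_bcontfun g))) = T (apply_bcontfun g)"
    if "g \<in> S" for g
    using T_bcontfun[OF that] by (simp add: Bcontfun_inverse)
  define c where "c = Max ((\<lambda>n. \<bar>\<gamma> n\<bar>) ` {1..N})"
  have c_ge: "\<bar>\<gamma> n\<bar> \<le> c" if "n \<in> {1..N}" for n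
    unfolding c_def using that by (intro Max_ge) auto
  have "c \<in> (\<lambda>n. \<bar>\<gamma> n\<bar>) ` {1..N}"
    unfolding c_def using N_pos by (intro Max_in) auto
  then have c: "0 \<le> c" "c < 1" using \<gamma> by auto
  have "\<exists>!g\<in>S. Bcontfun (T (apply_bcontfun g)) = g"
  proof (rule Banach_fix[OF _ _ c])
    show "complete S"
      unfolding S_def complete_eq_closed by (intro closed_PiC) auto
    show "S \<noteq> {}"
    proof -
      (* the chord between the two end points, continued by constants to stay bounded *)
      obtain a b where ab: "a * x 0 + b = z 0" "a * x N + b = z N"
        using affine_interpolation[of "x 0" "x N" "z 0" "z N"] x_ends by auto
      define k where "k t = a * max (x 0) (min (x N) t) + b" for t
      have "continuous_on UNIV k" unfolding k_def by (intro continuous_intros)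
      moreover have "range k \<subseteq> (\<lambda>t. a * t + b) ` I"
        using x_ends by (auto simp: k_def)
      moreover have "bounded ((\<lambda>t. a * t + b) ` I)"
        by (intro compact_imp_bounded compact_continuous_image continuous_intros) auto
      ultimately have "k \<in> bcontfun"
        using bounded_subset unfolding bcontfun_def by blast
      then obtain K where K: "k = apply_bcontfun K" by (rule bcontfunE)
      then have "K \<in> S" using x_ends ab by (simp add: S_iff K[symmetric] k_def)
      then show ?thesis by auto
    qed
    show "(\<lambda>g. Bcontfun (T (apply_bcontfun g))) ` S \<subseteq> S"
    proof (rule image_subsetI)
      fix g assume g: "g \<in> S"
      then have "apply_bcontfun g (x 0) = z 0" "apply_bcontfun g (x N) = z N"
        by (auto simp: S_iff)
      then show "Bcontfun (T (apply_bcontfun g)) \<in> S"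
        using pieces by (simp add: S_iff app[OF g])
    qed
    fix f g assume f: "f \<in> S" and g: "g \<in> S"
    have fe: "apply_bcontfun f (x 0) = z 0" "apply_bcontfun f (x N) = z N"
      and ge: "apply_bcontfun g (x 0) = z 0" "apply_bcontfun g (x N) = z N"
      using f g by (auto simp: S_iff)
    show "dist (Bcontfun (T (apply_bcontfun f))) (Bcontfun (T (apply_bcontfun g))) \<le> c * dist f g"
    proof (rule dist_bound, unfold app[OF f] app[OF g])
      fix t
      show "dist (T (apply_bcontfun f) t) (T (apply_bcontfun g) t) \<le> c * dist f g"
      proof (cases "t \<in> I")
        case False
        then show ?thesis
          using pieces[OF fe] pieces[OF ge] c
          by (smt (verit) atLeastAtMost_iff dist_self mult_nonneg_nonneg zero_le_dist)
      next
        case True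
        then obtain n s where n: "n \<in> {1..N}" "s \<in> I" "t = L n s" by (rule L_cover)
        have "x (n - 1) \<le> t" "t \<le> x n" using L_in_I[OF n(1,2)] n(3) by auto
        then have "dist (T (apply_bcontfun f) t) (T (apply_bcontfun g) t) =
            \<bar>\<gamma> n\<bar> * dist (apply_bcontfun f s) (apply_bcontfun g s)"
          using pieces(1)[OF fe n(1)] pieces(1)[OF ge n(1)] L_inv_L[OF n(1,2)] n(3)
          by (simp add: h_def dist_real_def abs_mult[symmetric] algebra_simps)
        also have "\<dots> \<le> c * dist f g"
          using c_ge[OF n(1)] c by (intro mult_mono dist_bounded) auto
        finally show ?thesis .
      qed
    qed
  qed
  then obtain g where g: "g \<in> S" "Bcontfun (T (apply_bcontfun g)) = g" by blast
  define G where "G = apply_bcontfun g"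
  have fixp: "T G = G" using app[OF g(1)] g(2) by (simp add: G_def)
  have ends: "G (x 0) = z 0" "G (x N) = z N" using g(1) by (auto simp: S_iff G_def)
  have eqn: "G (L n t) = \<gamma> n * G t + r n t" if n: "n \<in> {1..N}" "t \<in> I" for n t
    using pieces(1)[OF ends n(1), of "L n t"] L_in_I[OF n] L_inv_L[OF n]
    by (simp add: fixp h_def)
  show ?thesis
  proof
    show "continuous_on I G" by (simp add: G_def)
    show "G (L n t) = \<gamma> n * G t + r n t" if "n \<in> {1..N}" "t \<in> I" for n t
      using eqn[OF that] .
    show "G (x i) = z i" if "i \<le> N" for i
    proof (cases "i = 0")
      case False
      then have i: "i \<in> {1..N}" using that by simp
      have "G (x i) = G (L i (x N))" by (simp add: L_right)
      also have "\<dots> = \<gamma> i * z N + r i (x N)"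
        using eqn[OF i x_in_I[of N]] ends by simp
      finally show ?thesis using joinN[OF i] by simp
    qed (simp add: ends)
  qed
qed

text \<open>
  With zero values at the nodes the affine terms vanish at both end points, hence identically. At
  a point \<^term>\<open>L n u\<close> where \<open>\<bar>g\<bar>\<close> is maximal this leaves \<open>\<bar>g (L n u)\<bar> = \<bar>\<gamma> n\<bar> * \<bar>g u\<bar>\<close>, and
  \<open>\<bar>\<gamma> n\<bar> < 1\<close> makes the maximum zero.
\<close>

lemma interpolant_zero:
  fixes \<gamma> a b :: "nat \<Rightarrow> real"
  assumes \<gamma>: "\<And>n. n \<in> {1..N} \<Longrightarrow> \<bar>\<gamma> n\<bar> < 1"
    and cont: "continuous_on I g"
    and eqn: "\<And>n t. n \<in> {1..N} \<Longrightarrow> t \<in> I \<Longrightarrow> g (L n t) = \<gamma> n * g t + (a n * t + b n)"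
    and nodes: "\<And>i. i \<le> N \<Longrightarrow> g (x i) = 0"
    and t: "t \<in> I"
  shows "g t = 0"
proof -
  have ab: "a n = 0" "b n = 0" if n: "n \<in> {1..N}" for n
  proof -
    have n1: "n - 1 \<le> N" using n by auto
    have "a n * x 0 + b n = 0" "a n * x N + b n = 0"
      using eqn[OF n x_in_I[of 0]] eqn[OF n x_in_I[of N]]
        nodes[of 0] nodes[of N] nodes[of n] nodes[of "n - 1", OF n1] n
      by (simp_all add: L_left L_right)
    then show "a n = 0" "b n = 0"
      using affine_two_zeros[of "x 0" "x N" "a n" "b n"] x_ends by auto
  qed
  have "continuous_on I (\<lambda>t. \<bar>g t\<bar>)" using cont by (intro continuous_intros)
  then obtain s where s: "s \<in> I" "\<And>t. t \<in> I \<Longrightarrow> \<bar>g t\<bar> \<le> \<bar>g s\<bar>"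
    using continuous_attains_sup[of I "\<lambda>t. \<bar>g t\<bar>"] x_ends by auto
  obtain n u where n: "n \<in> {1..N}" "u \<in> I" "s = L n u" using L_cover[OF s(1)] .
  have "\<bar>g s\<bar> = \<bar>\<gamma> n\<bar> * \<bar>g u\<bar>"
    using eqn[OF n(1,2)] ab[OF n(1)] n(3) by (simp add: abs_mult)
  also have "\<dots> \<le> \<bar>\<gamma> n\<bar> * \<bar>g s\<bar>" by (intro mult_left_mono s n) auto
  finally have "(1 - \<bar>\<gamma> n\<bar>) * \<bar>g s\<bar> \<le> 0" by (simp add: algebra_simps)
  then have "g s = 0" using \<gamma>[OF n(1)] by (simp add: mult_le_0_iff)
  then show ?thesis using s(2)[OF t] by simp
qed

end

section \<open>The space of vector-valued interpolation functions\<close>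

locale hidden_variable_system = interpolation_nodes +
  fixes \<alpha> \<beta> \<gamma> :: "nat \<Rightarrow> real"
  assumes \<alpha>: "\<And>n. n \<in> {1..N} \<Longrightarrow> \<bar>\<alpha> n\<bar> < 1"
    and \<gamma>: "\<And>n. n \<in> {1..N} \<Longrightarrow> \<bar>\<gamma> n\<bar> < 1"
begin

abbreviation F where "F \<equiv> ifs_vertical_map \<alpha> \<beta> \<gamma>"
abbreviation S where "S \<equiv> S0 N x \<alpha> \<beta> \<gamma>"

text \<open>
  The data can be read off as the node values of \<^term>\<open>f\<close>: evaluated at the end points of the
  interval, the functional equation is the join-up condition for them. Membership thus becomes a
  condition that is visibly linear in \<^term>\<open>f\<close>.
\<close>

lemma mem_S_iff:
  "f \<in> S \<longleftrightarrow> continuous_on I f \<and> (\<forall>t. t \<notin> I \<longrightarrow> f t = (0, 0)) \<and>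
     (\<exists>c d e h. \<forall>n\<in>{1..N}. \<forall>t\<in>I. f (L n t) = F c d e h n t (f t))" (is "_ \<longleftrightarrow> ?R")
proof
  assume "f \<in> S"
  then show ?R
    unfolding S0_def hidden_variable_fif_def Let_def by blast
next
  assume R: ?R
  then obtain c d e h where eqn: "\<forall>n\<in>{1..N}. \<forall>t\<in>I. f (L n t) = F c d e h n t (f t)"
    by blast
  have "F c d e h n (x 0) (f (x 0)) = f (x (n - 1)) \<and> F c d e h n (x N) (f (x N)) = f (x n)"
    if "n \<in> {1..N}" for n
    using eqn[rule_format, OF that x_in_I[of 0]] eqn[rule_format, OF that x_in_I[of N]]
    unfolding L_left L_right by simp
  then have "join_up N x (\<lambda>i. fst (f (x i))) (\<lambda>i. snd (f (x i))) (F c d e h)"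
    unfolding join_up_def prod.collapse by blast
  then have "hidden_variable_fif N x \<alpha> \<beta> \<gamma> (\<lambda>i. fst (f (x i))) (\<lambda>i. snd (f (x i))) f"
    using R eqn unfolding hidden_variable_fif_def Let_def by blast
  then show "f \<in> S" unfolding S0_def by blast
qed

lemma S_outside: "f \<in> S \<Longrightarrow> t \<notin> I \<Longrightarrow> f t = 0"
  unfolding mem_S_iff zero_prod_def by blast

lemma S_continuous:
  assumes "f \<in> S"
  shows "continuous_on I (\<lambda>t. fst (f t))" "continuous_on I (\<lambda>t. snd (f t))"
  using assms unfolding mem_S_iff by (auto intro: continuous_on_fst continuous_on_snd)

lemma S_equations:
  assumes "f \<in> S"
  shows "\<exists>c d. \<forall>n\<in>{1..N}. \<forall>t\<in>I.
      fst (f (L n t)) = \<alpha> n * fst (f t) + \<beta> n * snd (f t) + (c n * t + d n)"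
    and "\<exists>e h. \<forall>n\<in>{1..N}. \<forall>t\<in>I. snd (f (L n t)) = \<gamma> n * snd (f t) + (e n * t + h n)"
proof -
  obtain c d e h where eqn: "\<forall>n\<in>{1..N}. \<forall>t\<in>I. f (L n t) = F c d e h n t (f t)"
    using assms unfolding mem_S_iff by blast
  show "\<exists>c d. \<forall>n\<in>{1..N}. \<forall>t\<in>I.
      fst (f (L n t)) = \<alpha> n * fst (f t) + \<beta> n * snd (f t) + (c n * t + d n)"
    by (intro exI[of _ c] exI[of _ d] ballI) (simp only: eqn ifs_vertical_map_def fst_conv)
  show "\<exists>e h. \<forall>n\<in>{1..N}. \<forall>t\<in>I. snd (f (L n t)) = \<gamma> n * snd (f t) + (e n * t + h n)"
    by (intro exI[of _ e] exI[of _ h] ballI) (simp only: eqn ifs_vertical_map_def snd_conv)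
qed

lemma S_I:
  assumes "\<And>n t. n \<in> {1..N} \<Longrightarrow> t \<in> I \<Longrightarrow>
      u (L n t) = \<alpha> n * u t + \<beta> n * v t + (c n * t + d n)"
    and "\<And>n t. n \<in> {1..N} \<Longrightarrow> t \<in> I \<Longrightarrow> v (L n t) = \<gamma> n * v t + (e n * t + h n)"
    and "continuous_on I u" "continuous_on I v"
  shows "(\<lambda>t. if t \<in> I then (u t, v t) else 0) \<in> S"
  unfolding mem_S_iff
proof (intro conjI exI ballI allI impI)
  have "continuous_on I (\<lambda>t. (u t, v t))" using assms by (intro continuous_intros)
  then show "continuous_on I (\<lambda>t. if t \<in> I then (u t, v t) else 0)"
    by (rule continuous_on_eq) simp
  show "(if L n t \<in> I then (u (L n t), v (L n t)) else 0) =
      F c d e h n t (if t \<in> I then (u t, v t) else 0)" if "n \<in> {1..N}" "t \<in> I" for n t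
    using assms(1,2)[OF that] L_in_I(1)[OF that] that(2) by (simp add: ifs_vertical_map_def)
qed (auto simp: zero_prod_def)

lemma S_add_scale:
  assumes "f \<in> S" "g \<in> S"
  shows "(\<lambda>t. k *\<^sub>R f t + g t) \<in> S"
proof -
  obtain c d e h where f: "\<forall>n\<in>{1..N}. \<forall>t\<in>I. f (L n t) = F c d e h n t (f t)"
    using assms(1) unfolding mem_S_iff by blast
  obtain c' d' e' h' where g: "\<forall>n\<in>{1..N}. \<forall>t\<in>I. g (L n t) = F c' d' e' h' n t (g t)"
    using assms(2) unfolding mem_S_iff by blast
  have "\<forall>n\<in>{1..N}. \<forall>t\<in>I. k *\<^sub>R f (L n t) + g (L n t) =
      F (\<lambda>n. k * c n + c' n) (\<lambda>n. k * d n + d' n) (\<lambda>n. k * e n + e' n) (\<lambda>n. k * h n + h' n) n t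
        (k *\<^sub>R f t + g t)"
    using f g by (simp add: ifs_vertical_map_def algebra_simps)
  moreover have "continuous_on I (\<lambda>t. k *\<^sub>R f t + g t)"
    using assms by (intro continuous_intros) (auto simp: mem_S_iff)
  ultimately show ?thesis
    using assms unfolding mem_S_iff by (auto simp: zero_prod_def[symmetric])
qed

text \<open>
  These functions are the kernel of the projection to the first component. They satisfy the
  equations because an affine function composed with \<^term>\<open>L n\<close> is affine, so that the coefficients
  \<open>c, d\<close> can cancel the coupling term and \<open>e, h\<close> can produce the second component.
\<close>

lemma S_affine_snd: "(\<lambda>t. if t \<in> I then (0, a * t + b) else 0) \<in> S"
proof (rule S_I)
  let ?A = "\<lambda>n. (x n - x (n - 1)) / (x N - x 0)"
  let ?B = "\<lambda>n. (x N * x (n - 1) - x 0 * x n) / (x N - x 0)"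
  have push: "a * (A * t + B) + b = g * (a * t + b) + ((a * A - g * a) * t + (a * B + b - g * b))"
    for A B g t :: real
    by (simp add: algebra_simps)
  show "0 = \<alpha> n * 0 + \<beta> n * (a * t + b) + (- (\<beta> n * a) * t + - (\<beta> n * b))" for n t
    by (simp add: algebra_simps)
  show "a * L n t + b = \<gamma> n * (a * t + b) +
      ((a * ?A n - \<gamma> n * a) * t + (a * ?B n + b - \<gamma> n * b))" for n t
    unfolding affine_contraction_def by (rule push)
qed (intro continuous_intros)+

lemma S_zero: "(\<lambda>t. 0) \<in> S"
proof -
  have "(\<lambda>t. if t \<in> I then (0, 0 * t + 0) else 0) = (\<lambda>t. 0 :: real \<times> real)"
    by (rule ext) (simp add: prod_eq_iff)
  then show ?thesis using S_affine_snd[of 0 0] by (simp only:)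
qed

lemma S_sum:
  assumes "finite K" "\<And>k. k \<in> K \<Longrightarrow> \<phi> k \<in> S"
  shows "(\<lambda>t. \<Sum>k\<in>K. c k *\<^sub>R \<phi> k t) \<in> S"
  using assms
proof (induction K rule: finite_induct)
  case empty
  then show ?case using S_zero by simp
next
  case (insert k K)
  then have "(\<lambda>t. c k *\<^sub>R \<phi> k t + (\<Sum>k\<in>K. c k *\<^sub>R \<phi> k t)) \<in> S"
    by (intro S_add_scale) auto
  then show ?case using insert.hyps by simp
qed

text \<open>
  The second equation does not involve the first component. Its solution \<open>f\<^sub>2\<close> is then a known
  continuous function, and \<open>\<beta> n * f\<^sub>2 t\<close> joins the inhomogeneity of the first equation. The affine
  terms are determined by their two prescribed values in the join-up conditions.
\<close>

lemma S_interpolation_exists: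
  obtains f where "f \<in> S" "\<And>i. i \<le> N \<Longrightarrow> f (x i) = (y i, z i)"
proof -
  have aff: "\<exists>ab. fst ab * x 0 + snd ab = u \<and> fst ab * x N + snd ab = w" for u w :: real
  proof -
    obtain a b where "a * x 0 + b = u" "a * x N + b = w"
      using affine_interpolation[of "x 0" "x N" u w] x_ends by auto
    then show ?thesis by (intro exI[of _ "(a, b)"]) simp
  qed
  have "\<forall>n. \<exists>ab. fst ab * x 0 + snd ab = z (n - 1) - \<gamma> n * z 0 \<and>
      fst ab * x N + snd ab = z n - \<gamma> n * z N"
    using aff by blast
  from choice[OF this] obtain q where q: "fst (q n) * x 0 + snd (q n) = z (n - 1) - \<gamma> n * z 0"
      "fst (q n) * x N + snd (q n) = z n - \<gamma> n * z N" for n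
    by blast
  obtain v where v: "continuous_on I v"
    "\<And>n t. n \<in> {1..N} \<Longrightarrow> t \<in> I \<Longrightarrow> v (L n t) = \<gamma> n * v t + (fst (q n) * t + snd (q n))"
    "\<And>i. i \<le> N \<Longrightarrow> v (x i) = z i"
    by (rule interpolant_exists[of \<gamma> "\<lambda>n t. fst (q n) * t + snd (q n)" z])
      (use \<gamma> q in \<open>auto intro!: continuous_intros\<close>)
  have "\<forall>n. \<exists>ab. fst ab * x 0 + snd ab = y (n - 1) - \<alpha> n * y 0 - \<beta> n * z 0 \<and>
      fst ab * x N + snd ab = y n - \<alpha> n * y N - \<beta> n * z N"
    using aff by blast
  from choice[OF this] obtain p where
    p: "fst (p n) * x 0 + snd (p n) = y (n - 1) - \<alpha> n * y 0 - \<beta> n * z 0"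
      "fst (p n) * x N + snd (p n) = y n - \<alpha> n * y N - \<beta> n * z N" for n
    by blast
  obtain u where u: "continuous_on I u"
    "\<And>n t. n \<in> {1..N} \<Longrightarrow> t \<in> I \<Longrightarrow>
       u (L n t) = \<alpha> n * u t + (\<beta> n * v t + (fst (p n) * t + snd (p n)))"
    "\<And>i. i \<le> N \<Longrightarrow> u (x i) = y i"
    by (rule interpolant_exists[of \<alpha> "\<lambda>n t. \<beta> n * v t + (fst (p n) * t + snd (p n))" y])
      (use \<alpha> p v in \<open>auto intro!: continuous_intros\<close>)
  show ?thesis
  proof
    show "(\<lambda>t. if t \<in> I then (u t, v t) else 0) \<in> S"
      by (rule S_I[of _ _ "\<lambda>n. fst (p n)" "\<lambda>n. snd (p n)" "\<lambda>n. fst (q n)" "\<lambda>n. snd (q n)"])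
        (use u v in auto)
    show "(if x i \<in> I then (u (x i), v (x i)) else 0) = (y i, z i)" if "i \<le> N" for i
      using x_in_I[OF that] u(3)[OF that] v(3)[OF that] by simp
  qed
qed

lemma S_zero_if_zero_at_nodes:
  assumes f: "f \<in> S" and nodes: "\<And>i. i \<le> N \<Longrightarrow> f (x i) = 0"
  shows "f t = 0"
proof (cases "t \<in> I")
  case False
  then show ?thesis by (rule S_outside[OF f])
next
  case True
  obtain c d where u: "\<forall>n\<in>{1..N}. \<forall>t\<in>I.
      fst (f (L n t)) = \<alpha> n * fst (f t) + \<beta> n * snd (f t) + (c n * t + d n)"
    using S_equations(1)[OF f] by blast
  obtain e h where v: "\<forall>n\<in>{1..N}. \<forall>t\<in>I.
      snd (f (L n t)) = \<gamma> n * snd (f t) + (e n * t + h n)"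
    using S_equations(2)[OF f] by blast
  have v0: "snd (f t) = 0" if "t \<in> I" for t
    by (rule interpolant_zero[of \<gamma> "\<lambda>t. snd (f t)" e h, OF \<gamma> S_continuous(2)[OF f] v[rule_format] _ that])
      (simp_all add: nodes)
  have u': "fst (f (L n t)) = \<alpha> n * fst (f t) + (c n * t + d n)"
    if "n \<in> {1..N}" "t \<in> I" for n t
    using u[rule_format, OF that] v0[OF that(2)] by (simp only: mult_zero_right add_0_right)
  have "fst (f t) = 0"
    by (rule interpolant_zero[of \<alpha> "\<lambda>t. fst (f t)" c d, OF \<alpha> S_continuous(1)[OF f] u' _ True])
      (simp_all add: nodes)
  then show ?thesis using v0[OF True] by (simp add: prod_eq_iff)
qed

lemma S_eqI:
  assumes f: "f \<in> S" and g: "g \<in> S" and nodes: "\<And>i. i \<le> N \<Longrightarrow> f (x i) = g (x i)"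
  shows "f = g"
proof
  fix t
  have "-1 *\<^sub>R f t + g t = 0"
    by (rule S_zero_if_zero_at_nodes[OF S_add_scale[OF f g, of "-1"]]) (simp add: nodes)
  then show "f t = g t" by simp
qed

text \<open>
  This is where the coupling of the components matters: for \<open>N > 1\<close> an index with \<open>\<beta> n \<noteq> 0\<close>
  lets the first equation be solved for the second component, which is then an affine function
  with two zeros.
\<close>

lemma S_zero_if_fst_zero:
  assumes coupled: "N = 1 \<or> (\<exists>n\<in>{1..N}. \<beta> n \<noteq> 0)"
    and f: "f \<in> S" and fst0: "\<And>t. fst (f t) = 0"
    and ends: "snd (f (x 0)) = 0" "snd (f (x N)) = 0"
  shows "f t = 0"
proof (cases "N = 1")
  case True
  have "f (x i) = 0" if "i \<le> N" for i
  proof -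
    have "i = 0 \<or> i = N" using that True by auto
    then show ?thesis using ends fst0 by (auto simp: prod_eq_iff)
  qed
  then show ?thesis by (rule S_zero_if_zero_at_nodes[OF f])
next
  case False
  then obtain n where n: "n \<in> {1..N}" "\<beta> n \<noteq> 0" using coupled by blast
  obtain c d where u: "\<forall>n\<in>{1..N}. \<forall>t\<in>I.
      fst (f (L n t)) = \<alpha> n * fst (f t) + \<beta> n * snd (f t) + (c n * t + d n)"
    using S_equations(1)[OF f] by blast
  have eqn: "\<beta> n * snd (f t) + (c n * t + d n) = 0" if "t \<in> I" for t
    using u[rule_format, OF n(1) that] fst0 by simp
  have "c n * x 0 + d n = 0" "c n * x N + d n = 0"
    using eqn[OF x_in_I[of 0]] eqn[OF x_in_I[of N]] ends by auto
  then have "c n = 0" "d n = 0" using affine_two_zeros[of "x 0" "x N" "c n" "d n"] x_ends by auto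
  then have "snd (f t) = 0" if "t \<in> I" for t using eqn[OF that] n(2) by simp
  then show ?thesis using S_outside[OF f, of t] fst0 by (auto simp: prod_eq_iff)
qed

section \<open>The space of first components\<close>

text \<open>
  Subtracting from the second component the affine function with the same end point values leaves
  the first component unchanged.
\<close>

lemma chfif_normalized:
  assumes "u \<in> chfif_space N x \<alpha> \<beta> \<gamma>"
  obtains f where "f \<in> S" "u = fst \<circ> f" "snd (f (x 0)) = 0" "snd (f (x N)) = 0"
proof -
  obtain g where g: "g \<in> S" "u = fst \<circ> g" using assms by (auto simp: chfif_space_def)
  obtain a b where ab: "a * x 0 + b = snd (g (x 0))" "a * x N + b = snd (g (x N))"
    using affine_interpolation[of "x 0" "x N" "snd (g (x 0))" "snd (g (x N))"] x_ends by auto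
  let ?A = "\<lambda>t. if t \<in> I then (0, a * t + b) else 0"
  show ?thesis
  proof
    show "(\<lambda>t. -1 *\<^sub>R ?A t + g t) \<in> S" by (rule S_add_scale[OF S_affine_snd g(1)])
  qed (use ab x_ends g(2) in \<open>auto simp: fun_eq_iff\<close>)
qed

lemma subspace_chfif: "fun_vs.subspace (chfif_space N x \<alpha> \<beta> \<gamma>)"
proof (rule fun_vs.subspaceI)
  show "0 \<in> chfif_space N x \<alpha> \<beta> \<gamma>"
    unfolding chfif_space_def by (rule image_eqI[OF _ S_zero]) (simp add: fun_eq_iff)
next
  fix u v assume "u \<in> chfif_space N x \<alpha> \<beta> \<gamma>" "v \<in> chfif_space N x \<alpha> \<beta> \<gamma>"
  then obtain f g where fg: "f \<in> S" "u = fst \<circ> f" "g \<in> S" "v = fst \<circ> g"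
    by (auto simp: chfif_space_def)
  show "u + v \<in> chfif_space N x \<alpha> \<beta> \<gamma>"
    unfolding chfif_space_def
    by (rule image_eqI[OF _ S_add_scale[OF fg(1,3), of 1]]) (simp add: fun_eq_iff fg)
next
  fix k u assume "u \<in> chfif_space N x \<alpha> \<beta> \<gamma>"
  then obtain f where f: "f \<in> S" "u = fst \<circ> f" by (auto simp: chfif_space_def)
  show "(\<lambda>t. k * u t) \<in> chfif_space N x \<alpha> \<beta> \<gamma>"
    unfolding chfif_space_def
    by (rule image_eqI[OF _ S_add_scale[OF f(1) S_zero, of k]]) (simp add: fun_eq_iff f)
qed

end

lemma sum_fun_apply: "(\<Sum>k\<in>K. f k) t = (\<Sum>k\<in>K. f k t)"
  for f :: "'k \<Rightarrow> 'a \<Rightarrow> 'b::comm_monoid_add"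
  by (induction K rule: infinite_finite_induct) simp_all

text \<open>
  A version of the basis criterion for an indexed family, with pointwise linear combinations. That
  the family is injective follows from independence: equal members \<open>b i = b j\<close> would give the
  relation \<open>b i - b j = 0\<close>.
\<close>

lemma dim_eq_card_index:
  fixes b :: "'k \<Rightarrow> real \<Rightarrow> real"
  assumes V: "fun_vs.subspace V" and K: "finite K" and bV: "\<And>k. k \<in> K \<Longrightarrow> b k \<in> V"
    and span: "\<And>u. u \<in> V \<Longrightarrow> \<exists>c. \<forall>t. u t = (\<Sum>k\<in>K. c k * b k t)"
    and indep: "\<And>c k. (\<And>t. (\<Sum>k\<in>K. c k * b k t) = 0) \<Longrightarrow> k \<in> K \<Longrightarrow> c k = 0"
  shows "fun_vs.dim V = card K"
proof -
  have inj: "inj_on b K"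
  proof (rule inj_onI, rule ccontr)
    fix i j assume ij: "i \<in> K" "j \<in> K" "b i = b j" "i \<noteq> j"
    let ?c = "\<lambda>k. (if k = i then 1 else 0) - (if k = j then 1 else (0::real))"
    have "(\<Sum>k\<in>K. ?c k * b k t) = 0" for t
      using K ij by (simp add: left_diff_distrib sum_subtractf if_distrib[of "\<lambda>a. a * _"] cong: if_cong)
    from indep[of ?c i, OF this ij(1)] show False using ij(4) by simp
  qed
  show ?thesis
  proof (rule fun_vs.dim_unique[of "b ` K"])
    show "b ` K \<subseteq> V" using bV by auto
    show "V \<subseteq> fun_vs.span (b ` K)"
    proof
      fix u assume "u \<in> V"
      then obtain c where "\<forall>t. u t = (\<Sum>k\<in>K. c k * b k t)" using span by blast
      then have "u = (\<Sum>k\<in>K. (\<lambda>t. c k * b k t))" by (simp add: fun_eq_iff sum_fun_apply)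
      also have "\<dots> \<in> fun_vs.span (b ` K)"
        by (intro fun_vs.span_sum fun_vs.span_scale fun_vs.span_base) auto
      finally show "u \<in> fun_vs.span (b ` K)" .
    qed
    show "fun_vs.independent (b ` K)"
    proof (rule fun_vs.independent_if_scalars_zero)
      fix f v assume 0: "(\<Sum>v\<in>b ` K. (\<lambda>t. f v * v t)) = 0" and v: "v \<in> b ` K"
      then obtain k where k: "k \<in> K" "v = b k" by blast
      have "(\<Sum>k\<in>K. f (b k) * b k t) = 0" for t
        using fun_cong[OF 0, of t] by (simp add: sum_fun_apply sum.reindex[OF inj])
      then show "f v = 0" using indep[of "\<lambda>k. f (b k)" k] k by simp
    qed (use K in simp)
    show "card (b ` K) = card K" by (rule card_image[OF inj])
  qed
qed

context hidden_variable_system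
begin

text \<open>
  The \<open>2 * N\<close> coordinates of a normalized pair: the indices \<open>0, \<dots>, N\<close> stand for the values of the
  first component at all nodes, and \<open>N + 1, \<dots>, 2 * N - 1\<close> for those of the second component at the
  interior nodes.
\<close>

definition node_value :: "nat \<Rightarrow> (real \<Rightarrow> real \<times> real) \<Rightarrow> real" where
  "node_value k f = (if k \<le> N then fst (f (x k)) else snd (f (x (k - N))))"

lemma node_value_sum:
  "node_value i (\<lambda>t. \<Sum>k\<in>K. c k *\<^sub>R \<phi> k t) = (\<Sum>k\<in>K. c k * node_value i (\<phi> k))"
  by (simp add: node_value_def fst_sum snd_sum)

lemma S_eq_if_node_values_eq:
  assumes "f \<in> S" "g \<in> S"
    and ends: "snd (f (x 0)) = 0" "snd (f (x N)) = 0" "snd (g (x 0)) = 0" "snd (g (x N)) = 0"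
    and vals: "\<And>k. k < 2 * N \<Longrightarrow> node_value k f = node_value k g"
  shows "f = g"
proof (rule S_eqI[OF assms(1,2)])
  fix i assume i: "i \<le> N"
  have "fst (f (x i)) = fst (g (x i))"
    using vals[of i] i N_pos by (simp add: node_value_def)
  moreover have "snd (f (x i)) = snd (g (x i))"
  proof (cases "i = 0 \<or> i = N")
    case False
    then show ?thesis using vals[of "N + i"] i by (simp add: node_value_def)
  qed (use ends in auto)
  ultimately show "f (x i) = g (x i)" by (simp add: prod_eq_iff)
qed

lemma cardinal_functions_exist:
  obtains \<phi> where "\<And>k. \<phi> k \<in> S" "\<And>k. snd (\<phi> k (x 0)) = 0" "\<And>k. snd (\<phi> k (x N)) = 0"
    "\<And>i k. i < 2 * N \<Longrightarrow> node_value i (\<phi> k) = (if i = k then 1 else 0)"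
proof -
  have "\<exists>f. f \<in> S \<and> (\<forall>i\<le>N. f (x i) = (if i = k then 1 else 0,
      if 0 < i \<and> i < N \<and> N + i = k then 1 else 0))" for k
    using S_interpolation_exists[of "\<lambda>i. if i = k then 1 else 0"
        "\<lambda>i. if 0 < i \<and> i < N \<and> N + i = k then 1 else 0"] by metis
  then obtain \<phi> where \<phi>: "\<And>k. \<phi> k \<in> S" "\<And>k i. i \<le> N \<Longrightarrow> \<phi> k (x i) =
      (if i = k then 1 else 0, if 0 < i \<and> i < N \<and> N + i = k then 1 else 0)"
    by metis
  show ?thesis
  proof
    show "node_value i (\<phi> k) = (if i = k then 1 else 0)" if "i < 2 * N" for i k
      using that \<phi>(2)[of i k] \<phi>(2)[of "i - N" k] by (auto simp: node_value_def)
  qed (use \<phi> in auto)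
qed

text \<open>
  A linear combination of cardinal functions has its coefficients as coordinates. Hence it
  reproduces every normalized pair, which gives spanning, and if its first component vanishes the
  whole pair vanishes together with the coefficients, which gives independence.
\<close>

lemma dim_chfif:
  assumes coupled: "N = 1 \<or> (\<exists>n\<in>{1..N}. \<beta> n \<noteq> 0)"
  shows "fun_vs.dim (chfif_space N x \<alpha> \<beta> \<gamma>) = 2 * N"
proof -
  obtain \<phi> where \<phi>: "\<And>k. \<phi> k \<in> S" "\<And>k. snd (\<phi> k (x 0)) = 0" "\<And>k. snd (\<phi> k (x N)) = 0"
    "\<And>i k. i < 2 * N \<Longrightarrow> node_value i (\<phi> k) = (if i = k then 1 else 0)"
    using cardinal_functions_exist by blast
  define comb where "comb c t = (\<Sum>k<2 * N. c k *\<^sub>R \<phi> k t)" for c t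
  have comb: "comb c \<in> S" "snd (comb c (x 0)) = 0" "snd (comb c (x N)) = 0" for c
    using S_sum[of "{..<2 * N}" \<phi> c] \<phi> by (simp_all add: comb_def[abs_def] snd_sum)
  have comb_val: "node_value i (comb c) = c i" if "i < 2 * N" for i c
  proof -
    have "node_value i (comb c) = (\<Sum>k<2 * N. c k * (if i = k then 1 else 0))"
      by (simp only: comb_def[abs_def] node_value_sum \<phi>(4)[OF that])
    also have "\<dots> = (\<Sum>k<2 * N. if i = k then c k else 0)"
      by (rule sum.cong) auto
    also have "\<dots> = c i" using that by simp
    finally show ?thesis .
  qed
  have fst_comb: "fst (comb c t) = (\<Sum>k<2 * N. c k * (fst \<circ> \<phi> k) t)" for c t
    by (simp add: comb_def fst_sum)
  have "fun_vs.dim (chfif_space N x \<alpha> \<beta> \<gamma>) = card {..<2 * N}"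
  proof (rule dim_eq_card_index[OF subspace_chfif, of _ "\<lambda>k. fst \<circ> \<phi> k"])
    show "fst \<circ> \<phi> k \<in> chfif_space N x \<alpha> \<beta> \<gamma>" for k
      using \<phi>(1) by (auto simp: chfif_space_def)
  next
    fix u assume "u \<in> chfif_space N x \<alpha> \<beta> \<gamma>"
    then obtain f where f: "f \<in> S" "u = fst \<circ> f" "snd (f (x 0)) = 0" "snd (f (x N)) = 0"
      by (rule chfif_normalized)
    have "f = comb (\<lambda>k. node_value k f)"
      using comb f comb_val by (intro S_eq_if_node_values_eq) auto
    then have "u t = (\<Sum>k<2 * N. node_value k f * (fst \<circ> \<phi> k) t)" for t
      using f(2) fst_comb by (metis comp_apply)
    then show "\<exists>c. \<forall>t. u t = (\<Sum>k<2 * N. c k * (fst \<circ> \<phi> k) t)"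
      by (intro exI[of _ "\<lambda>k. node_value k f"] allI)
  next
    fix c k assume "\<And>t. (\<Sum>k<2 * N. c k * (fst \<circ> \<phi> k) t) = 0" and k: "k \<in> {..<2 * N}"
    then have "fst (comb c t) = 0" for t by (simp add: fst_comb)
    then have "comb c t = 0" for t
      by (intro S_zero_if_fst_zero[OF coupled]) (use comb in auto)
    then have "node_value k (comb c) = 0" by (simp add: node_value_def)
    then show "c k = 0" using comb_val[of k c] k by simp
  qed simp
  then show ?thesis by simp
qed

end

theorem proposition2p2:
  fixes N :: nat and x \<alpha> \<beta> \<gamma> :: "nat \<Rightarrow> real"
  assumes "1 \<le> N"
    and "strict_mono_on {0..N} x"
    and "\<And>n. n \<in> {1..N} \<Longrightarrow> \<bar>\<alpha> n\<bar> < 1"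
    and "\<And>n. n \<in> {1..N} \<Longrightarrow> \<bar>\<gamma> n\<bar> < 1"
    and "\<And>n. n \<in> {1..N} \<Longrightarrow> \<bar>\<beta> n\<bar> + \<bar>\<gamma> n\<bar> < 1"
    and "N = 1 \<or> (\<exists>n\<in>{1..N}. \<beta> n \<noteq> 0)"
  shows "fun_vs.subspace (chfif_space N x \<alpha> \<beta> \<gamma>) \<and>
         fun_vs.dim (chfif_space N x \<alpha> \<beta> \<gamma>) = 2 * N"
proof -
  interpret hidden_variable_system N x \<alpha> \<beta> \<gamma>
    using assms by unfold_locales auto
  show ?thesis using subspace_chfif dim_chfif[OF assms(6)] by simp
qed

end
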